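(* Let $(X,d)$ be a nonempty complete metric space, let $\alpha\in(0,1)$, and let $\phi:[0,+\infty)\to[0,+\infty)$ be a Lebesgue measurable function which has finite Lebesgue integral on each compact subset of $[0,+\infty)$ and satisfies $\int_0^{\epsilon}\phi(t)\,dt>0$ for each $\epsilon>0$. Let $T,f:X\to X$ be mappings such that $T$ is continuous, one-to-one and subsequentially convergent, and such that $f$ is a $T_{\int\phi}$-contraction with constant $\alpha$, i.e. $$\int_0^{d(Tfx,\,Tfy)}\phi(t)\,dt\;\le\;\alpha\int_0^{d(Tx,\,Ty)}\phi(t)\,dt\qquad\text{for all }x,y\in X.$$ Then $f$ has a unique fixed point $a\in X$. Moreover, if $T$ is in addition sequentially convergent, then for each $x_0\in X$ the sequence of iterates $\{f^n x_0\}$ converges to this fixed point $a$.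
   Context: Let $(X,d)$ be a metric space and $T:X\to X$ a mapping. $T$ is called sequentially convergent if for every sequence $\{y_n\}$ in $X$, whenever $\{Ty_n\}$ converges in $X$, the sequence $\{y_n\}$ also converges in $X$. $T$ is called subsequentially convergent if for every sequence $\{y_n\}$ in $X$, whenever $\{Ty_n\}$ converges in $X$, the sequence $\{y_n\}$ has a subsequence that converges in $X$. Notation: $Tfx=T(f(x))$, and $f^n$ denotes the $n$-fold composition of $f$ with itself. *)

theory Defs
  imports "HOL-Analysis.Analysis"
begin

definition sequentially_convergent :: "('a::metric_space \<Rightarrow> 'a) \<Rightarrow> bool" where
  "sequentially_convergent T \<longleftrightarrow>
     (\<forall>y :: nat \<Rightarrow> 'a. convergent (\<lambda>n. T (y n)) \<longrightarrow> convergent y)"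

definition subsequentially_convergent :: "('a::metric_space \<Rightarrow> 'a) \<Rightarrow> bool" where
  "subsequentially_convergent T \<longleftrightarrow>
     (\<forall>y :: nat \<Rightarrow> 'a. convergent (\<lambda>n. T (y n)) \<longrightarrow>
        (\<exists>r :: nat \<Rightarrow> nat. strict_mono r \<and> convergent (y \<circ> r)))"

text \<open>
  A function \<open>\<phi> : [0, \<infinity>) \<rightarrow> [0, \<infinity>)\<close> is represented by a function on all reals
  whose values at negative arguments are irrelevant: only its restriction to
  \<open>{0..}\<close> is constrained or used. Since \<open>\<phi>\<close> is nonnegative and measurable there,
  a finite Lebesgue integral over \<open>K\<close> is integrability over \<open>K\<close>.
\<close>

definition T_integral_contraction ::
  "('a::metric_space \<Rightarrow> 'a) \<Rightarrow> (real \<Rightarrow> real) \<Rightarrow> real \<Rightarrow> ('a \<Rightarrow> 'a) \<Rightarrow> bool" where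
  "T_integral_contraction T \<phi> \<alpha> f \<longleftrightarrow>
     (\<forall>x y. (LINT t:{0..dist (T (f x)) (T (f y))}|lebesgue. \<phi> t)
            \<le> \<alpha> * (LINT t:{0..dist (T x) (T y)}|lebesgue. \<phi> t))"

end

theory Submission
  imports Defs
begin

text \<open>
  Write \<open>\<Phi>(s)\<close> for the integral of \<open>\<phi>\<close> over \<open>[0, s]\<close>. It is monotone, continuous and positive
  for positive \<open>s\<close>. These three properties turn the integral inequality into a
  condition of Meir--Keeler type on distances: since \<open>\<alpha> \<Phi>(\<epsilon>) < \<Phi>(\<epsilon>)\<close>, continuity gives a
  \<open>\<delta> > 0\<close> with \<open>\<alpha> \<Phi>(\<epsilon> + \<delta>) < \<Phi>(\<epsilon>)\<close>, and then monotonicity forces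
  \<open>d(Tfx, Tfy) < \<epsilon>\<close> whenever \<open>d(Tx, Ty) < \<epsilon> + \<delta>\<close>
  (\<open>integral_contraction_imp_meir_keeler\<close>). The remaining argument is purely metric.

  The Meir--Keeler condition makes every sequence \<open>T(f\<^sup>n x)\<close> Cauchy
  (\<open>meir_keeler_sequence_Cauchy\<close>), hence convergent, and subsequential convergence of \<open>T\<close>
  provides a cluster point of the iterates \<open>f\<^sup>n x\<close> themselves.
  The condition also gives \<open>d(Tfx, Tfy) \<le> d(Tx, Ty)\<close>, so along the corresponding subsequence
  \<open>T(f\<^bsup>n+1\<^esup> x)\<close> tends to \<open>Tfa\<close> as well as to \<open>Ta\<close>; injectivity of \<open>T\<close> yields \<open>fa = a\<close>
  (\<open>cluster_point_of_iterates_fixed\<close>). Strictness for \<open>x \<noteq> y\<close> gives uniqueness. If \<open>T\<close> is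
  sequentially convergent, the whole sequence of iterates converges, and its limit is a cluster
  point, hence the fixed point.
\<close>

section \<open>The Meir--Keeler condition relative to a map\<close>

text \<open>
  For \<open>T = id\<close> this is equivalent to the classical condition, in which the hypothesis on \<open>x, y\<close>
  also contains \<open>\<epsilon> \<le> dist x y\<close>.
\<close>

definition meir_keeler :: "('b \<Rightarrow> 'a::metric_space) \<Rightarrow> ('b \<Rightarrow> 'b) \<Rightarrow> bool" where
  "meir_keeler T f \<longleftrightarrow> (\<forall>\<epsilon>>0. \<exists>\<delta>>0. \<forall>x y.
     dist (T x) (T y) < \<epsilon> + \<delta> \<longrightarrow> dist (T (f x)) (T (f y)) < \<epsilon>)"

lemma meir_keelerE:
  assumes "meir_keeler T f" "0 < \<epsilon>"
  obtains \<delta> where "0 < \<delta>"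
    "\<And>x y. dist (T x) (T y) < \<epsilon> + \<delta> \<Longrightarrow> dist (T (f x)) (T (f y)) < \<epsilon>"
  using assms unfolding meir_keeler_def by meson

lemma meir_keeler_strict:
  assumes "meir_keeler T f" "T x \<noteq> T y"
  shows "dist (T (f x)) (T (f y)) < dist (T x) (T y)"
proof -
  have "0 < dist (T x) (T y)" using assms(2) by simp
  from meir_keelerE[OF assms(1) this] show ?thesis
    by (metis less_add_same_cancel1)
qed

text \<open>
  Applying the condition with \<open>\<epsilon> = dist (T x) (T y) + e\<close> for arbitrary \<open>e > 0\<close> also covers
  \<open>T x = T y\<close>, where \<open>\<epsilon> = dist (T x) (T y)\<close> would not be positive.
\<close>

lemma meir_keeler_nonexpansive:
  assumes "meir_keeler T f"
  shows "dist (T (f x)) (T (f y)) \<le> dist (T x) (T y)"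
proof (rule field_le_epsilon)
  fix e :: real assume "0 < e"
  then have pos: "0 < dist (T x) (T y) + e"
    by (simp add: add_nonneg_pos)
  obtain \<delta> where "0 < \<delta>" "\<And>x' y'. dist (T x') (T y') < dist (T x) (T y) + e + \<delta> \<Longrightarrow>
      dist (T (f x')) (T (f y')) < dist (T x) (T y) + e"
    using meir_keelerE[OF assms pos] by blast
  then show "dist (T (f x)) (T (f y)) \<le> dist (T x) (T y) + e"
    using \<open>0 < e\<close> by (meson add_pos_pos less_add_same_cancel1 less_imp_le less_trans)
qed

text \<open>
  The consecutive distances decrease, and a positive limit \<open>L\<close> is impossible: once a distance
  is below \<open>L + \<delta>\<close>, the next one is below \<open>L\<close>.
\<close>

lemma meir_keeler_consecutive_dist_tendsto_0:
  assumes "meir_keeler T f"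
  shows "(\<lambda>n. dist (T ((f ^^ n) x)) (T ((f ^^ Suc n) x))) \<longlonglongrightarrow> 0"
proof -
  define d where "d n = dist (T ((f ^^ n) x)) (T ((f ^^ Suc n) x))" for n
  have "decseq d"
    unfolding decseq_Suc_iff d_def using meir_keeler_nonexpansive[OF assms] by simp
  then obtain L where L: "d \<longlonglongrightarrow> L" "\<And>n. L \<le> d n"
    using decseq_convergent[of d 0] by (auto simp: d_def)
  have "0 \<le> L"
    using L(1) by (rule LIMSEQ_le_const) (simp add: d_def)
  moreover have "\<not> 0 < L"
  proof
    assume "0 < L"
    from meir_keelerE[OF assms this] obtain \<delta> where \<delta>: "0 < \<delta>"
      "\<And>x y. dist (T x) (T y) < L + \<delta> \<Longrightarrow> dist (T (f x)) (T (f y)) < L" by blast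
    have "\<forall>\<^sub>F n in sequentially. d n < L + \<delta>"
      using order_tendstoD(2)[OF L(1)] \<delta>(1) by simp
    then obtain n where "d n < L + \<delta>"
      by (auto simp: eventually_sequentially)
    then have "d (Suc n) < L"
      using \<delta>(2) by (simp add: d_def)
    then show False using L(2)[of "Suc n"] by simp
  qed
  ultimately show ?thesis using L(1) by (simp add: d_def[abs_def])
qed

text \<open>
  Once consecutive distances are below \<open>\<delta>\<close>, the ball of radius \<open>\<epsilon> + \<delta>\<close> around a term of the
  sequence traps all later terms: applying \<open>f\<close> to both arguments shrinks the distance below \<open>\<epsilon>\<close>,
  and moving the centre back by one step costs less than \<open>\<delta>\<close>.
\<close>

lemma meir_keeler_sequence_Cauchy:
  assumes "meir_keeler T f"
  shows "Cauchy (\<lambda>n. T ((f ^^ n) x))"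
proof (rule metric_CauchyI)
  define u where "u n = T ((f ^^ n) x)" for n
  fix e :: real assume "0 < e"
  \<comment> \<open>Two later terms lie within \<open>e / 4 + \<delta> \<le> e / 2\<close> of a common term, hence within \<open>e\<close>.\<close>
  then have "0 < e / 4" by simp
  from meir_keelerE[OF assms this] obtain \<delta>' where \<delta>': "0 < \<delta>'"
    "\<And>x y. dist (T x) (T y) < e / 4 + \<delta>' \<Longrightarrow> dist (T (f x)) (T (f y)) < e / 4" by blast
  define \<delta> where "\<delta> = min \<delta>' (e / 4)"
  have \<delta>: "0 < \<delta>" "\<delta> \<le> e / 4"
    using \<delta>'(1) \<open>0 < e\<close> by (auto simp: \<delta>_def)
  have contract: "dist (u (Suc m)) (u (Suc n)) < e / 4" if "dist (u m) (u n) < e / 4 + \<delta>" for m n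
    using that \<delta>'(2) by (simp add: u_def \<delta>_def)
  have "\<forall>\<^sub>F n in sequentially. dist (u n) (u (Suc n)) < \<delta>"
    using order_tendstoD(2)[OF meir_keeler_consecutive_dist_tendsto_0[OF assms] \<delta>(1)]
    by (simp add: u_def)
  then obtain N where N: "dist (u N) (u (Suc N)) < \<delta>"
    by (auto simp: eventually_sequentially)
  have near: "dist (u N) (u m) < e / 4 + \<delta>" if "N \<le> m" for m
    using that
  proof (induction m rule: dec_induct)
    case base
    then show ?case using \<delta> \<open>0 < e\<close> by simp
  next
    case (step m)
    have "dist (u N) (u (Suc m)) \<le> dist (u N) (u (Suc N)) + dist (u (Suc N)) (u (Suc m))"
      by (rule dist_triangle)
    then show ?case using N contract[OF step.IH] by simp
  qed
  have "dist (u m) (u n) < e" if "N \<le> m" "N \<le> n" for m n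
    using dist_triangle2[of "u m" "u n" "u N"] near[OF that(1)] near[OF that(2)] \<delta>(2)
    by (simp add: dist_commute)
  then show "\<exists>M. \<forall>m\<ge>M. \<forall>n\<ge>M. dist (T ((f ^^ m) x)) (T ((f ^^ n) x)) < e"
    unfolding u_def by blast
qed

lemma cluster_point_of_iterates_fixed:
  fixes T :: "'a::complete_space \<Rightarrow> 'b::complete_space"
  assumes mk: "meir_keeler T f" and T: "continuous_on UNIV T" "inj T"
    and r: "strict_mono r" "(\<lambda>n. (f ^^ r n) x) \<longlonglongrightarrow> a"
  shows "f a = a"
proof -
  obtain l where l: "(\<lambda>n. T ((f ^^ n) x)) \<longlonglongrightarrow> l"
    using meir_keeler_sequence_Cauchy[OF mk] by (meson Cauchy_convergent convergentD)
  have Ta: "(\<lambda>n. T ((f ^^ r n) x)) \<longlonglongrightarrow> T a"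
    using T(1) r(2) by (rule continuous_on_tendsto_compose) auto
  moreover have "(\<lambda>n. T ((f ^^ r n) x)) \<longlonglongrightarrow> l"
    using LIMSEQ_subseq_LIMSEQ[OF l r(1)] by (simp add: o_def)
  ultimately have "l = T a" by (metis LIMSEQ_unique)
  then have shifted: "(\<lambda>n. T (f ((f ^^ r n) x))) \<longlonglongrightarrow> T a"
    using LIMSEQ_subseq_LIMSEQ[OF LIMSEQ_Suc[OF l] r(1)] by (simp add: o_def)
  have "(\<lambda>n. dist (T ((f ^^ r n) x)) (T a)) \<longlonglongrightarrow> 0"
    using Ta by (rule tendsto_dist_iff[THEN iffD1])
  then have "(\<lambda>n. dist (T (f ((f ^^ r n) x))) (T (f a))) \<longlonglongrightarrow> 0"
    by (rule tendsto_sandwich[OF _ _ tendsto_const, rotated 2])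
      (simp_all add: meir_keeler_nonexpansive[OF mk])
  then have "(\<lambda>n. T (f ((f ^^ r n) x))) \<longlonglongrightarrow> T (f a)"
    by (rule tendsto_dist_iff[THEN iffD2])
  with shifted have "T (f a) = T a" by (metis LIMSEQ_unique)
  then show ?thesis using T(2) by (simp add: inj_eq)
qed

section \<open>From the integral inequality to the Meir--Keeler condition\<close>

lemma continuous_on_set_integral_upper:
  fixes \<phi> :: "real \<Rightarrow> real"
  assumes "set_integrable lebesgue {a..b} \<phi>"
  shows "continuous_on {a..b} (\<lambda>s. LINT t:{a..s}|lebesgue. \<phi> t)"
proof -
  have "integral {a..s} \<phi> = (LINT t:{a..s}|lebesgue. \<phi> t)" if "s \<in> {a..b}" for s
    using set_lebesgue_integral_eq_integral(2)[OF set_integrable_subset[OF assms, of "{a..s}"]] that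
    by simp
  moreover have "continuous_on {a..b} (\<lambda>s. integral {a..s} \<phi>)"
    by (intro indefinite_integral_continuous_1 set_lebesgue_integral_eq_integral(1) assms)
  ultimately show ?thesis by (subst continuous_on_cong[OF refl]) auto
qed

lemma set_integral_upper_mono:
  fixes \<phi> :: "real \<Rightarrow> real"
  assumes "set_integrable lebesgue {a..s'} \<phi>" "\<And>t. a \<le> t \<Longrightarrow> 0 \<le> \<phi> t" "s \<le> s'"
  shows "(LINT t:{a..s}|lebesgue. \<phi> t) \<le> (LINT t:{a..s'}|lebesgue. \<phi> t)"
proof -
  have "set_integrable lebesgue {a..s} \<phi>"
    using assms(1) by (rule set_integrable_subset) (use assms(3) in auto)
  then show ?thesis
    using assms unfolding set_lebesgue_integral_def set_integrable_def
    by (intro integral_mono) (auto simp: indicator_def)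
qed

text \<open>
  The strict inequality \<open>\<alpha> \<Phi>(\<epsilon>) < \<Phi>(\<epsilon>)\<close> persists slightly to the right of \<open>\<epsilon>\<close> because \<open>\<Phi>\<close> is
  continuous. No strict monotonicity of \<open>\<Phi>\<close> is available, since \<open>\<phi>\<close> may vanish away from \<open>0\<close>;
  the conclusion \<open>d < \<epsilon>\<close> is drawn from \<open>\<Phi>(d) < \<Phi>(\<epsilon>)\<close>, for which weak monotonicity suffices.
\<close>

lemma integral_contraction_imp_meir_keeler:
  fixes \<phi> :: "real \<Rightarrow> real"
  assumes "\<alpha> < 1" "0 \<le> \<alpha>"
    and nonneg: "\<And>t. 0 \<le> t \<Longrightarrow> 0 \<le> \<phi> t"
    and int: "\<And>b. set_integrable lebesgue {0..b} \<phi>"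
    and pos: "\<And>\<epsilon>. 0 < \<epsilon> \<Longrightarrow> 0 < (LINT t:{0..\<epsilon>}|lebesgue. \<phi> t)"
    and contr: "T_integral_contraction T \<phi> \<alpha> f"
  shows "meir_keeler T f"
  unfolding meir_keeler_def
proof (intro allI impI)
  fix \<epsilon> :: real assume "0 < \<epsilon>"
  define \<Phi> where "\<Phi> s = (LINT t:{0..s}|lebesgue. \<phi> t)" for s
  have mono: "\<Phi> s \<le> \<Phi> s'" if "s \<le> s'" for s s'
    unfolding \<Phi>_def using int nonneg that by (rule set_integral_upper_mono)
  have "continuous_on {0..\<epsilon> + 1} \<Phi>"
    unfolding \<Phi>_def using int by (rule continuous_on_set_integral_upper)
  then have "isCont \<Phi> \<epsilon>"
    by (rule continuous_on_interior) (use \<open>0 < \<epsilon>\<close> in simp)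
  then have "((\<lambda>s. \<alpha> * \<Phi> s) \<longlongrightarrow> \<alpha> * \<Phi> \<epsilon>) (at \<epsilon>)"
    by (intro tendsto_mult_left) (simp add: isCont_def)
  moreover have "\<alpha> * \<Phi> \<epsilon> < \<Phi> \<epsilon>"
    using pos[OF \<open>0 < \<epsilon>\<close>] \<open>\<alpha> < 1\<close> by (simp add: \<Phi>_def)
  ultimately have "\<forall>\<^sub>F s in at \<epsilon>. \<alpha> * \<Phi> s < \<Phi> \<epsilon>"
    by (rule order_tendstoD(2))
  then obtain \<eta> where \<eta>: "0 < \<eta>" "\<And>s. s \<noteq> \<epsilon> \<Longrightarrow> dist s \<epsilon> < \<eta> \<Longrightarrow> \<alpha> * \<Phi> s < \<Phi> \<epsilon>"
    unfolding eventually_at by blast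
  have gap: "\<alpha> * \<Phi> (\<epsilon> + \<eta> / 2) < \<Phi> \<epsilon>"
    using \<eta>(1) by (intro \<eta>(2)) (auto simp: dist_real_def)
  show "\<exists>\<delta>>0. \<forall>x y. dist (T x) (T y) < \<epsilon> + \<delta> \<longrightarrow> dist (T (f x)) (T (f y)) < \<epsilon>"
  proof (intro exI[of _ "\<eta> / 2"] conjI allI impI)
    fix x y assume "dist (T x) (T y) < \<epsilon> + \<eta> / 2"
    have "\<Phi> (dist (T (f x)) (T (f y))) \<le> \<alpha> * \<Phi> (dist (T x) (T y))"
      using contr by (simp add: T_integral_contraction_def \<Phi>_def)
    also have "\<dots> \<le> \<alpha> * \<Phi> (\<epsilon> + \<eta> / 2)"
      using \<open>dist (T x) (T y) < _\<close> \<open>0 \<le> \<alpha>\<close> by (intro mult_left_mono mono) auto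
    also have "\<dots> < \<Phi> \<epsilon>" by (rule gap)
    finally show "dist (T (f x)) (T (f y)) < \<epsilon>"
      using mono[of \<epsilon> "dist (T (f x)) (T (f y))"] by linarith
  qed (use \<eta>(1) in simp)
qed

section \<open>The fixed point theorem\<close>

theorem theorem2p5:
  fixes T f :: "'a::complete_space \<Rightarrow> 'a"
    and \<phi> :: "real \<Rightarrow> real"
    and \<alpha> :: real
  assumes "0 < \<alpha>" and "\<alpha> < 1"
    and "\<And>t. 0 \<le> t \<Longrightarrow> 0 \<le> \<phi> t"
    and "\<phi> \<in> borel_measurable (lebesgue_on {0..})"
    and "\<And>K. compact K \<Longrightarrow> K \<subseteq> {0..} \<Longrightarrow> set_integrable lebesgue K \<phi>"
    and "\<And>\<epsilon>. 0 < \<epsilon> \<Longrightarrow> 0 < (LINT t:{0..\<epsilon>}|lebesgue. \<phi> t)"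
    and "continuous_on UNIV T" and "inj T" and "subsequentially_convergent T"
    and "T_integral_contraction T \<phi> \<alpha> f"
  shows "\<exists>a. f a = a \<and> (\<forall>b. f b = b \<longrightarrow> b = a) \<and>
             (sequentially_convergent T \<longrightarrow> (\<forall>x\<^sub>0. (\<lambda>n. (f ^^ n) x\<^sub>0) \<longlonglongrightarrow> a))"
proof -
  have "set_integrable lebesgue {0..b} \<phi>" for b
    by (rule assms(5)) auto
  then have mk: "meir_keeler T f"
    using integral_contraction_imp_meir_keeler[of \<alpha> \<phi> T f] assms(1-3,6,10) by simp
  have fixed: "f a = a" if "strict_mono r" "(\<lambda>n. (f ^^ r n) x) \<longlonglongrightarrow> a" for r x a
    using cluster_point_of_iterates_fixed[OF mk assms(7,8)] that by blast
  have Tconv: "convergent (\<lambda>n. T ((f ^^ n) x))" for x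
    using meir_keeler_sequence_Cauchy[OF mk] by (rule Cauchy_convergent)
  have unique: "b = a" if "f a = a" "f b = b" for a b
    using meir_keeler_strict[OF mk, of a b] that injD[OF assms(8)] by force
  obtain r and a :: 'a where r: "strict_mono r" "(\<lambda>n. (f ^^ r n) undefined) \<longlonglongrightarrow> a"
    using assms(9) Tconv[of undefined]
    unfolding subsequentially_convergent_def convergent_def o_def by meson
  have a: "f a = a" using fixed[OF r] .
  have "(\<lambda>n. (f ^^ n) x) \<longlonglongrightarrow> a" if "sequentially_convergent T" for x
  proof -
    have "convergent (\<lambda>n. (f ^^ n) x)"
      using that[unfolded sequentially_convergent_def, rule_format, OF Tconv] .
    then obtain b where b: "(\<lambda>n. (f ^^ n) x) \<longlonglongrightarrow> b"
      by (auto simp: convergent_def)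
    have "f b = b"
      using fixed[of "\<lambda>n. n"] b by (simp add: strict_mono_def)
    then show ?thesis using unique[OF a] b by blast
  qed
  with a unique show ?thesis by blast
qed

end
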